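(* Let $X$ be a hereditarily Lindelöf, strong Choquet, submetrizable topological space. Then $\mathsf{OGA}^{*}(X)$ holds; that is, for every partition $[X]^{2}=K_{0}\cup K_{1}$ with $K_{0}$ open in $[X]^2$, either there is a perfect $K_{0}$-homogeneous set $P\subseteq X$, or $X$ is the union of countably many $K_{1}$-homogeneous sets.
   Context: $[X]^2$ is the collection of two-element subsets of $X$. A set $K\subseteq [X]^2$ is open if $\{\langle x,y\rangle\in X^2:\{x,y\}\in K\}$ is open in the product space $X^2$. A set $Y\subseteq X$ is $K_i$-homogeneous if $[Y]^2\subseteq K_i$. A subset $P \subseteq X$ is perfect if it is nonempty, closed in $X$, and has no isolated points (as a subspace). A space is hereditarily Lindelöf if every subspace is Lindelöf. A space is submetrizable if it has a weaker (coarser) metrizable topology. The strong Choquet game on $X$: at round $n$, Player I plays a pair $\langle x_n,U_n\rangle$ with $U_n\subseteq X$ open and $x_n\in U_n$ (and $U_n\subseteq V_{n-1}$ if $n\geq 1$); Player II answers with an open set $V_n$ with $x_n\in V_n\subseteq U_n$. Player II wins the run if $\bigcap_{n}U_n=\bigcap_n V_n\neq\emptyset$. A nonempty space $X$ is strong Choquet if Player II has a winning strategy in this game. *)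

theory Defs
  imports "HOL-Analysis.Analysis" "HOL-Library.Ramsey"
begin

definition submetrizable_space :: "'a topology \<Rightarrow> bool" where
  "submetrizable_space X \<longleftrightarrow>
     (\<exists>Y. metrizable_space Y \<and> topspace Y = topspace X \<and> (\<forall>U. openin Y U \<longrightarrow> openin X U))"

text \<open>
  Since Player II's answers are determined by the strategy, a strategy for Player II maps the
  list of Player I's moves so far (pairs of a point and an open set, oldest first) to a set.
  Player I's moves are given by the sequences \<open>x\<close> and \<open>U\<close>.
\<close>

definition choquet_reply ::
    "(('a \<times> 'a set) list \<Rightarrow> 'a set) \<Rightarrow> (nat \<Rightarrow> 'a) \<Rightarrow> (nat \<Rightarrow> 'a set) \<Rightarrow> nat \<Rightarrow> 'a set" where
  "choquet_reply \<sigma> x U n = \<sigma> (map (\<lambda>k. (x k, U k)) [0..<Suc n])"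

definition choquet_legal_I ::
    "'a topology \<Rightarrow> (nat \<Rightarrow> 'a) \<Rightarrow> (nat \<Rightarrow> 'a set) \<Rightarrow> (nat \<Rightarrow> 'a set) \<Rightarrow> nat \<Rightarrow> bool" where
  "choquet_legal_I X x U V n \<longleftrightarrow>
     openin X (U n) \<and> x n \<in> U n \<and> (n \<ge> 1 \<longrightarrow> U n \<subseteq> V (n - 1))"

definition choquet_legal_II ::
    "'a topology \<Rightarrow> (nat \<Rightarrow> 'a) \<Rightarrow> (nat \<Rightarrow> 'a set) \<Rightarrow> (nat \<Rightarrow> 'a set) \<Rightarrow> nat \<Rightarrow> bool" where
  "choquet_legal_II X x U V n \<longleftrightarrow> openin X (V n) \<and> x n \<in> V n \<and> V n \<subseteq> U n"

text \<open>
  Legality of the replies is demanded after every finite legal play of Player I, not only along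
  infinite runs: otherwise an illegal reply such as the empty set, after which Player I has no
  legal move, would win vacuously.
\<close>

definition strong_choquet_winning_II ::
    "'a topology \<Rightarrow> (('a \<times> 'a set) list \<Rightarrow> 'a set) \<Rightarrow> bool" where
  "strong_choquet_winning_II X \<sigma> \<longleftrightarrow>
     (\<forall>x U. let V = choquet_reply \<sigma> x U in
        (\<forall>n. (\<forall>k\<le>n. choquet_legal_I X x U V k) \<longrightarrow> choquet_legal_II X x U V n) \<and>
        ((\<forall>n. choquet_legal_I X x U V n) \<longrightarrow>
           (\<Inter>n. U n) = (\<Inter>n. V n) \<and> (\<Inter>n. V n) \<noteq> {}))"

definition strong_choquet_space :: "'a topology \<Rightarrow> bool" where
  "strong_choquet_space X \<longleftrightarrow>
     topspace X \<noteq> {} \<and> (\<exists>\<sigma>. strong_choquet_winning_II X \<sigma>)"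

definition open_in_pairs :: "'a topology \<Rightarrow> 'a set set \<Rightarrow> bool" where
  "open_in_pairs X K \<longleftrightarrow>
     K \<subseteq> [topspace X]\<^bsup>2\<^esup> \<and>
     openin (prod_topology X X) {(x, y) \<in> topspace X \<times> topspace X. {x, y} \<in> K}"

definition homogeneous_in :: "'a topology \<Rightarrow> 'a set set \<Rightarrow> 'a set \<Rightarrow> bool" where
  "homogeneous_in X K Y \<longleftrightarrow> Y \<subseteq> topspace X \<and> [Y]\<^bsup>2\<^esup> \<subseteq> K"

definition perfect_in :: "'a topology \<Rightarrow> 'a set \<Rightarrow> bool" where
  "perfect_in X P \<longleftrightarrow>
     P \<noteq> {} \<and> closedin X P \<and> (\<forall>x\<in>P. \<not> openin (subtopology X P) {x})"

text \<open>As usual for partitions into colours, one of the two pieces may be empty.\<close>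

definition OGA_star :: "'a topology \<Rightarrow> bool" where
  "OGA_star X \<longleftrightarrow>
     (\<forall>K0 K1. [topspace X]\<^bsup>2\<^esup> = K0 \<union> K1 \<and> K0 \<inter> K1 = {} \<and> open_in_pairs X K0 \<longrightarrow>
        (\<exists>P. perfect_in X P \<and> homogeneous_in X K0 P) \<or>
        (\<exists>\<H>. countable \<H> \<and> (\<forall>Y\<in>\<H>. homogeneous_in X K1 Y) \<and> topspace X = \<Union>\<H>))"

end

theory Submission
  imports Defs
begin

text \<open>
  Suppose \<open>X\<close> is not a countable union of \<open>K1\<close>-homogeneous sets. The sets that are covered by
  countably many \<open>K1\<close>-homogeneous sets form a \<open>\<sigma>\<close>-ideal, and in a hereditarily Lindelof space the
  union of all open sets in a \<open>\<sigma>\<close>-ideal is again in the ideal. Removing it leaves a nonempty closed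
  set \<open>Z\<close> such that every open set meeting \<open>Z\<close> meets it in a set that is not \<open>K1\<close>-homogeneous,
  and so contains a pair of points of \<open>Z\<close> from \<open>K0\<close> (\<open>sigma_ideal_kernel\<close>).

  This allows a binary tree of plays of the strong Choquet game: after any position, two distinct
  points of \<open>Z\<close> forming a \<open>K0\<close>-pair are available in the last reply of Player II, and as \<open>K0\<close> is
  open Player I can continue with either of them, using neighbourhoods \<open>U\<close>, \<open>U'\<close> that satisfy
  \<open>U \<times> U' \<subseteq> K0\<close> and are small in the coarser metric. The winning strategy puts a point on
  every branch. Points on different branches form a \<open>K0\<close>-pair, and the point depends continuously
  on the branch with respect to the metric. So the points form the injective image of the Cantor
  space, which is metrically compact, hence closed in the metric topology and a fortiori in \<open>X\<close>
  (\<open>closed_uncountable_pairwise_related\<close>).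

  This set may still have isolated points in the finer topology of \<open>X\<close>. It is, however, uncountable,
  and a second application of \<open>sigma_ideal_kernel\<close>, to the ideal of countable sets, yields
  a perfect subset, as in the Cantor-Bendixson theorem.
\<close>

section \<open>Kernels of closed sets modulo a sigma-ideal\<close>

text \<open>
  The kernel is what remains of \<open>A\<close> after removing every open set \<open>V\<close> with \<open>V \<inter> A\<close> in the ideal
  \<open>I\<close>. Countably many of these \<open>V\<close> have the same union as all of them, so only a set in \<open>I\<close> has
  been removed.
\<close>

lemma sigma_ideal_kernel:
  assumes lind: "hereditarily Lindelof_space X"
    and sub: "\<And>B C. \<lbrakk>I C; B \<subseteq> C\<rbrakk> \<Longrightarrow> I B"
    and union: "\<And>\<C>. \<lbrakk>countable \<C>; \<And>C. C \<in> \<C> \<Longrightarrow> I C\<rbrakk> \<Longrightarrow> I (\<Union>\<C>)"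
    and A: "closedin X A" "\<not> I A"
  obtains Z where "Z \<subseteq> A" "closedin X Z" "Z \<noteq> {}"
    "\<And>V. \<lbrakk>openin X V; V \<inter> Z \<noteq> {}\<rbrakk> \<Longrightarrow> \<not> I (V \<inter> Z)"
proof -
  define \<V> where "\<V> = {V. openin X V \<and> I (V \<inter> A)}"
  define W where "W = \<Union>\<V>"
  have openW: "openin X W"
    unfolding W_def \<V>_def by blast
  have WX: "W \<subseteq> topspace X"
    using openW openin_subset by blast
  have "Lindelof_space (subtopology X W)"
    using lind WX by (simp add: hereditarily_def)
  moreover have "\<forall>V\<in>\<V>. openin X V" "W \<subseteq> \<Union>\<V>"
    by (auto simp: \<V>_def W_def)
  ultimately obtain \<V>' where \<V>': "countable \<V>'" "\<V>' \<subseteq> \<V>" "W \<subseteq> \<Union>\<V>'"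
    using Lindelof_space_subtopology_subset[OF WX] by metis
  have "I (\<Union>((\<lambda>V. V \<inter> A) ` \<V>'))"
    using \<V>' by (intro union) (auto simp: \<V>_def)
  then have IW: "I (W \<inter> A)"
    using \<V>'(3) by (elim sub) auto
  have two: "I (B \<union> C)" if "I B" "I C" for B C
    using union[of "{B, C}"] that by auto
  show thesis
  proof
    show "A - W \<subseteq> A" by blast
    show "closedin X (A - W)"
      using A openW by blast
    show "A - W \<noteq> {}"
      using IW A(2) sub[of "W \<inter> A" A] by blast
  next
    fix V assume V: "openin X V" "V \<inter> (A - W) \<noteq> {}"
    show "\<not> I (V \<inter> (A - W))"
    proof
      assume "I (V \<inter> (A - W))"
      then have "I (V \<inter> A)"
        using two[OF _ IW] sub[of "V \<inter> (A - W) \<union> W \<inter> A" "V \<inter> A"] by blast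
      then show False
        using V unfolding W_def \<V>_def by blast
    qed
  qed
qed

text \<open>
  For the ideal of countable sets the kernel consists of the condensation points, and an isolated
  point of the kernel would be an open subset of it in the ideal.
\<close>

lemma uncountable_closed_contains_perfect:
  assumes "hereditarily Lindelof_space X" "closedin X C" "uncountable C"
  obtains P where "P \<subseteq> C" "perfect_in X P"
proof -
  obtain P where P: "P \<subseteq> C" "closedin X P" "P \<noteq> {}"
    "\<And>V. \<lbrakk>openin X V; V \<inter> P \<noteq> {}\<rbrakk> \<Longrightarrow> uncountable (V \<inter> P)"
    using sigma_ideal_kernel[where I = countable, OF assms(1) _ _ assms(2,3)]
    by (metis countable_subset countable_UN[of _ "\<lambda>C. C"] image_ident)
  have "\<not> openin (subtopology X P) {x}" for x
  proof
    assume "openin (subtopology X P) {x}"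
    then obtain V where V: "openin X V" "{x} = V \<inter> P"
      by (auto simp: openin_subtopology)
    then have "uncountable {x}"
      using P(4)[OF V(1)] by auto
    then show False by simp
  qed
  then show thesis
    using that P by (auto simp: perfect_in_def)
qed

section \<open>Images of the Cantor space\<close>

lemma uncountable_UNIV_nat_bool: "uncountable (UNIV :: (nat \<Rightarrow> bool) set)"
proof
  assume "countable (UNIV :: (nat \<Rightarrow> bool) set)"
  then have "range (from_nat_into (UNIV :: (nat \<Rightarrow> bool) set)) = UNIV"
    by (simp add: range_from_nat_into)
  \<comment> \<open>The diagonal sequence would be enumerated.\<close>
  then obtain n where "from_nat_into UNIV n = (\<lambda>k. \<not> from_nat_into UNIV k k)"
    by (metis (no_types, lifting) UNIV_I imageE)
  then show False
    by metis
qed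

text \<open>
  The modulus of continuity makes \<open>p\<close> continuous on the Cantor space, so that its range is compact.
\<close>

lemma (in Metric_space) closedin_range_Cantor:
  fixes p :: "(nat \<Rightarrow> bool) \<Rightarrow> 'a"
  assumes pM: "range p \<subseteq> M"
    and e: "e \<longlonglongrightarrow> 0"
    and modulus: "\<And>f g n. (\<And>k. k \<le> n \<Longrightarrow> f k = g k) \<Longrightarrow> d (p f) (p g) \<le> e n"
  shows "closedin mtopology (range p)"
proof -
  define T where "T = product_topology (\<lambda>_::nat. discrete_topology (UNIV :: bool set)) UNIV"
  have [simp]: "topspace T = UNIV"
    by (simp add: T_def)
  have "compact_space T"
    unfolding T_def by (simp add: compact_space_product_topology compact_space_discrete_topology)
  moreover have "continuous_map T mtopology p"
    unfolding continuous_map_to_metric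
  proof (intro ballI allI impI)
    fix f and \<epsilon> :: real assume "\<epsilon> > 0"
    then obtain n where n: "e n < \<epsilon>"
      using order_tendstoD(2)[OF e] eventually_happens'[OF sequentially_bot] by blast
    let ?U = "PiE UNIV (\<lambda>k. if k \<le> n then {f k} else (UNIV :: bool set))"
    have "openin T ?U"
      unfolding T_def
      by (subst openin_PiE_gen) (auto intro: finite_subset[of _ "{..n}"])
    moreover have "f \<in> ?U" by auto
    moreover have "p g \<in> mball (p f) \<epsilon>" if "g \<in> ?U" for g
    proof -
      have "g k = f k" if "k \<le> n" for k
        using \<open>g \<in> ?U\<close> that by (auto simp: PiE_iff split: if_splits)
      then show ?thesis
        using modulus[of n f g] n pM by auto
    qed
    ultimately show "\<exists>U. openin T U \<and> f \<in> U \<and> (\<forall>g\<in>U. p g \<in> mball (p f) \<epsilon>)"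
      by blast
  qed
  ultimately have "compactin mtopology (range p)"
    using image_compactin[of T UNIV mtopology p] by (simp add: compact_space_def)
  then show ?thesis
    by (simp add: Hausdorff_space_mtopology compactin_imp_closedin)
qed

section \<open>Finite plays of the strong Choquet game\<close>

text \<open>The value at the empty play makes the first move of Player I obey the same rule as the others.\<close>

definition choquet_position ::
    "'a topology \<Rightarrow> (('a \<times> 'a set) list \<Rightarrow> 'a set) \<Rightarrow> ('a \<times> 'a set) list \<Rightarrow> 'a set" where
  "choquet_position X \<sigma> h = (if h = [] then topspace X else \<sigma> h)"

definition choquet_play ::
    "'a topology \<Rightarrow> (('a \<times> 'a set) list \<Rightarrow> 'a set) \<Rightarrow> ('a \<times> 'a set) list \<Rightarrow> bool" where
  "choquet_play X \<sigma> h \<longleftrightarrow>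
     (\<forall>k<length h. openin X (snd (h ! k)) \<and> fst (h ! k) \<in> snd (h ! k) \<and>
        snd (h ! k) \<subseteq> choquet_position X \<sigma> (take k h))"

lemma choquet_play_Nil [simp]: "choquet_play X \<sigma> []"
  by (simp add: choquet_play_def)

lemma choquet_play_snoc:
  "choquet_play X \<sigma> (h @ [m]) \<longleftrightarrow>
     choquet_play X \<sigma> h \<and> openin X (snd m) \<and> fst m \<in> snd m \<and> snd m \<subseteq> choquet_position X \<sigma> h"
  by (auto simp: choquet_play_def nth_append less_Suc_eq)

text \<open>
  Branching is expressed by appending moves to finite lists, whereas the winning condition is about
  infinite sequences of moves; this equivalence translates between the two.
\<close>

lemma legal_I_iff_choquet_play:
  "(\<forall>k<n. choquet_legal_I X (fst \<circ> F) (snd \<circ> F) (choquet_reply \<sigma> (fst \<circ> F) (snd \<circ> F)) k) \<longleftrightarrow>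
     choquet_play X \<sigma> (map F [0..<n])"
proof (induction n)
  case (Suc n)
  have "choquet_legal_I X (fst \<circ> F) (snd \<circ> F) (choquet_reply \<sigma> (fst \<circ> F) (snd \<circ> F)) n \<longleftrightarrow>
      openin X (snd (F n)) \<and> fst (F n) \<in> snd (F n) \<and>
      snd (F n) \<subseteq> choquet_position X \<sigma> (map F [0..<n])"
  proof (cases n)
    case 0
    then show ?thesis
      using openin_subset[of X "snd (F 0)"]
      by (auto simp: choquet_legal_I_def choquet_position_def)
  next
    case (Suc m)
    then show ?thesis
      by (simp add: choquet_legal_I_def choquet_reply_def choquet_position_def)
  qed
  then show ?case
    unfolding All_less_Suc Suc by (auto simp only: choquet_play_snoc upt_Suc_append map_append list.map le0)
qed simp

lemma choquet_position_legal:
  assumes win: "strong_choquet_winning_II X \<sigma>" and play: "choquet_play X \<sigma> (h @ [m])"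
  shows "openin X (choquet_position X \<sigma> (h @ [m]))" "fst m \<in> choquet_position X \<sigma> (h @ [m])"
proof -
  \<comment> \<open>Legality of a reply depends only on the moves up to it, so the unspecified values of
    \<open>F\<close> beyond the end of the list are harmless.\<close>
  define F where "F k = (h @ [m]) ! k" for k
  let ?n = "length h"
  let ?V = "choquet_reply \<sigma> (fst \<circ> F) (snd \<circ> F)"
  have h: "map F [0..<Suc ?n] = h @ [m]"
    unfolding F_def by (rule nth_equalityI) (auto simp del: upt_Suc)
  have "\<forall>k<Suc ?n. choquet_legal_I X (fst \<circ> F) (snd \<circ> F) ?V k"
    unfolding legal_I_iff_choquet_play h by (fact play)
  then have "choquet_legal_II X (fst \<circ> F) (snd \<circ> F) ?V ?n"
    using win unfolding strong_choquet_winning_II_def Let_def by (meson le_imp_less_Suc)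
  moreover have "?V ?n = choquet_position X \<sigma> (h @ [m])"
    using h by (simp add: choquet_reply_def choquet_position_def)
  moreover have "F ?n = m"
    by (simp add: F_def)
  ultimately show "openin X (choquet_position X \<sigma> (h @ [m]))"
      "fst m \<in> choquet_position X \<sigma> (h @ [m])"
    by (auto simp: choquet_legal_II_def)
qed

lemma choquet_branch_nonempty:
  assumes win: "strong_choquet_winning_II X \<sigma>" and play: "\<And>n. choquet_play X \<sigma> (map F [0..<n])"
  shows "(\<Inter>n. snd (F n)) \<noteq> {}"
proof -
  have "choquet_legal_I X (fst \<circ> F) (snd \<circ> F) (choquet_reply \<sigma> (fst \<circ> F) (snd \<circ> F)) n" for n
    using play[of "Suc n"] legal_I_iff_choquet_play[of "Suc n" X F \<sigma>] by blast
  then have "(\<Inter>n. (snd \<circ> F) n) \<noteq> {}"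
    using win unfolding strong_choquet_winning_II_def Let_def by metis
  then show ?thesis by simp
qed

section \<open>A Cantor scheme of plays\<close>

text \<open>
  The hypothesis on \<open>Z\<close> lets Player I branch at every position. The two branches are separated by
  a rectangle inside \<open>R\<close>, and the point on a branch inherits this separation because it lies in all
  sets that Player I has played.
\<close>

lemma closed_uncountable_pairwise_related:
  assumes choquet: "strong_choquet_space X" and subm: "submetrizable_space X"
    and R: "openin (prod_topology X X) R" "\<And>x. (x, x) \<notin> R"
    and Z: "Z \<subseteq> topspace X" "Z \<noteq> {}"
    and split: "\<And>V. \<lbrakk>openin X V; V \<inter> Z \<noteq> {}\<rbrakk> \<Longrightarrow> \<exists>x\<in>V \<inter> Z. \<exists>y\<in>V \<inter> Z. (x, y) \<in> R"
  obtains C where "closedin X C" "uncountable C" "pairwise (\<lambda>x y. (x, y) \<in> R \<or> (y, x) \<in> R) C"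
proof -
  obtain \<sigma> where win: "strong_choquet_winning_II X \<sigma>"
    using choquet by (auto simp: strong_choquet_space_def)
  obtain M d where "Metric_space M d" and "M = topspace X"
    and coarse: "\<And>U. openin (Metric_space.mtopology M d) U \<Longrightarrow> openin X U"
    using subm unfolding submetrizable_space_def metrizable_space_def
    by (metis Metric_space.topspace_mtopology)
  then interpret Metric_space M d by simp

  define good where "good h \<longleftrightarrow> choquet_play X \<sigma> h \<and> openin X (choquet_position X \<sigma> h) \<and>
    choquet_position X \<sigma> h \<inter> Z \<noteq> {}" for h
  \<comment> \<open>The radii shrink with the length of the play so that the point depends continuously on the
    branch.\<close>
  define r where "r h = 1 / real (Suc (length h))" for h :: "('a \<times> 'a set) list"
  have good_Nil: "good []"
    using Z by (auto simp: good_def choquet_position_def)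
  have "\<exists>m. (\<forall>b. good (h @ [m b]) \<and> snd (m b) \<subseteq> mball (fst (m b)) (r h)) \<and>
      snd (m False) \<times> snd (m True) \<subseteq> R" if "good h" for h
  proof -
    let ?V = "choquet_position X \<sigma> h"
    have V: "openin X ?V" "choquet_play X \<sigma> h"
      using \<open>good h\<close> by (auto simp: good_def)
    obtain x y where xy: "x \<in> ?V \<inter> Z" "y \<in> ?V \<inter> Z" "(x, y) \<in> R"
      using split \<open>good h\<close> unfolding good_def by blast
    obtain U U' where U: "openin X U" "x \<in> U" "openin X U'" "y \<in> U'" "U \<times> U' \<subseteq> R"
      using R(1) xy(3) unfolding openin_prod_topology_alt by meson
    have ball: "openin X (mball z (r h))" for z
      by (simp add: coarse)
    have "z \<in> mball z (r h)" if "z \<in> Z" for z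
      using that Z(1) \<open>M = topspace X\<close> centre_in_mball_iff[of z "r h"] by (auto simp: r_def)
    \<comment> \<open>Player I stays inside the last reply, inside the rectangle and inside a small ball.\<close>
    then have good: "good (h @ [(z, ?V \<inter> O' \<inter> mball z (r h))])"
      if "z \<in> ?V \<inter> Z" "openin X O'" "z \<in> O'" for z O'
    proof -
      have "choquet_play X \<sigma> (h @ [(z, ?V \<inter> O' \<inter> mball z (r h))])"
        using that V ball \<open>\<And>z. z \<in> Z \<Longrightarrow> z \<in> mball z (r h)\<close>
        by (auto simp del: in_mball simp: choquet_play_snoc)
      with choquet_position_legal[OF win this] that(1) show ?thesis
        by (auto simp: good_def)
    qed
    define m where "m b = (if b then (y, ?V \<inter> U' \<inter> mball y (r h)) else (x, ?V \<inter> U \<inter> mball x (r h)))"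
      for b
    have "good (h @ [m b]) \<and> snd (m b) \<subseteq> mball (fst (m b)) (r h)" for b
      using good[of x U] good[of y U'] xy U by (auto simp: m_def)
    moreover have "snd (m False) \<times> snd (m True) \<subseteq> R"
      using U(5) by (auto simp: m_def)
    ultimately show ?thesis by blast
  qed
  then obtain step where
    step_good: "\<And>h b. good h \<Longrightarrow> good (h @ [step h b])"
    and step_small: "\<And>h b. good h \<Longrightarrow> snd (step h b) \<subseteq> mball (fst (step h b)) (r h)"
    and step_R: "\<And>h. good h \<Longrightarrow> snd (step h False) \<times> snd (step h True) \<subseteq> R"
    by metis

  define H where "H f = rec_nat [] (\<lambda>n h. h @ [step h (f n)])" for f :: "nat \<Rightarrow> bool"
  have H_0 [simp]: "H f 0 = []" and H_Suc [simp]: "H f (Suc n) = H f n @ [step (H f n) (f n)]" for f n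
    by (simp_all add: H_def)
  define F where "F f n = step (H f n) (f n)" for f n
  have H_map: "H f n = map (F f) [0..<n]" for f n
    by (induction n) (simp_all add: F_def)
  have H_good: "good (H f n)" for f n
    by (induction n) (simp_all add: good_Nil step_good)
  have H_cong: "H f n = H g n" if "\<And>k. k < n \<Longrightarrow> f k = g k" for f g n
    using that by (induction n) auto
  have H_length: "length (H f n) = n" for f n
    by (simp add: H_map)

  have "\<exists>x. \<forall>n. x \<in> snd (F f n)" for f
  proof -
    have "(\<Inter>n. snd (F f n)) \<noteq> {}"
      by (rule choquet_branch_nonempty[OF win]) (use H_good[of f] in \<open>simp add: good_def H_map\<close>)
    then show ?thesis by blast
  qed
  then obtain p where p: "\<And>f n. p f \<in> snd (F f n)"
    by metis

  have p_ball: "p f \<in> mball (fst (F f n)) (1 / real (Suc n))" for f n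
    using p[of f n] step_small[OF H_good[of f n], of "f n"]
    unfolding F_def r_def H_length by blast
  have p_M: "range p \<subseteq> M"
    using p_ball by auto
  have p_close: "d (p f) (p g) \<le> 2 / real (Suc n)" if "\<And>k. k \<le> n \<Longrightarrow> f k = g k" for f g n
  proof -
    have "F f n = F g n"
      using H_cong[of n f g] that by (simp add: F_def)
    then have f: "p f \<in> mball (fst (F f n)) (1 / real (Suc n))"
      and g: "p g \<in> mball (fst (F f n)) (1 / real (Suc n))"
      using p_ball[of f n] p_ball[of g n] by simp_all
    have "d (p f) (p g) \<le> d (p f) (fst (F f n)) + d (fst (F f n)) (p g)"
      using f g unfolding in_mball by (blast intro: triangle)
    also have "\<dots> \<le> 1 / real (Suc n) + 1 / real (Suc n)"
      using f g unfolding in_mball by (metis add_mono commute less_imp_le)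
    finally show ?thesis by simp
  qed
  have p_R: "(p f, p g) \<in> R \<or> (p g, p f) \<in> R" if "f \<noteq> g" for f g
  proof -
    \<comment> \<open>The two plays coincide until the first difference, so there they take the two sides of one
      rectangle.\<close>
    obtain n where n: "f n \<noteq> g n" and less: "\<And>k. k < n \<Longrightarrow> f k = g k"
      using \<open>f \<noteq> g\<close> exists_least_iff[of "\<lambda>n. f n \<noteq> g n"] by blast
    have H: "H f n = H g n"
      by (rule H_cong) (rule less)
    let ?h = "H f n"
    have in_step: "p f \<in> snd (step ?h (f n))" "p g \<in> snd (step ?h (g n))"
      using p[of f n] p[of g n] unfolding F_def H by simp_all
    have "snd (step ?h False) \<times> snd (step ?h True) \<subseteq> R"
      by (rule step_R[OF H_good])
    with in_step n show ?thesis
      by (cases "f n"; cases "g n") auto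
  qed

  show thesis
  proof
    have "closedin mtopology (range p)"
    proof (rule closedin_range_Cantor[OF p_M])
      show "(\<lambda>n. 2 / real (Suc n)) \<longlonglongrightarrow> 0"
        using tendsto_mult_right_zero[OF LIMSEQ_inverse_real_of_nat, of 2] by (simp add: divide_inverse)
    qed (rule p_close)
    then show "closedin X (range p)"
      using coarse \<open>M = topspace X\<close> by (metis closedin_def topspace_mtopology)
    have "inj p"
      using p_R R(2) by (metis injI)
    then show "uncountable (range p)"
      using uncountable_UNIV_nat_bool countable_image_inj_on by blast
    show "pairwise (\<lambda>x y. (x, y) \<in> R \<or> (y, x) \<in> R) (range p)"
    proof (rule pairwiseI)
      fix x y assume "x \<in> range p" "y \<in> range p" "x \<noteq> y"
      then obtain f g where "x = p f" "y = p g" "f \<noteq> g" by blast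
      then show "(x, y) \<in> R \<or> (y, x) \<in> R"
        using p_R[of f g] by simp
    qed
  qed
qed

section \<open>The open graph axiom for perfect sets\<close>

theorem theorem3p1:
  fixes X :: "'a topology"
  assumes "hereditarily Lindelof_space X"
    and "strong_choquet_space X"
    and "submetrizable_space X"
  shows "OGA_star X"
  unfolding OGA_star_def
proof (intro allI impI, elim conjE)
  fix K0 K1
  assume K: "[topspace X]\<^bsup>2\<^esup> = K0 \<union> K1" and K0: "open_in_pairs X K0"
  \<comment> \<open>With \<open>\<subseteq>\<close> instead of equality, closure under subsets is immediate.\<close>
  define I where "I A \<longleftrightarrow> (\<exists>\<H>. countable \<H> \<and> (\<forall>Y\<in>\<H>. homogeneous_in X K1 Y) \<and> A \<subseteq> \<Union>\<H>)" for A
  define R where "R = {(x, y) \<in> topspace X \<times> topspace X. {x, y} \<in> K0}"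
  show "(\<exists>P. perfect_in X P \<and> homogeneous_in X K0 P) \<or>
    (\<exists>\<H>. countable \<H> \<and> (\<forall>Y\<in>\<H>. homogeneous_in X K1 Y) \<and> topspace X = \<Union>\<H>)"
  proof (cases "I (topspace X)")
    case True
    then obtain \<H> where \<H>: "countable \<H>" "\<forall>Y\<in>\<H>. homogeneous_in X K1 Y" "topspace X \<subseteq> \<Union>\<H>"
      by (auto simp: I_def)
    moreover have "\<Union>\<H> \<subseteq> topspace X"
      using \<H>(2) by (auto simp: homogeneous_in_def)
    ultimately show ?thesis by blast
  next
    case False
    have I_sub: "I B" if "I C" "B \<subseteq> C" for B C
      using that unfolding I_def by (meson subset_trans)
    have I_Union: "I (\<Union>\<C>)" if "countable \<C>" "\<And>C. C \<in> \<C> \<Longrightarrow> I C" for \<C>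
    proof -
      obtain h where h: "\<And>C. C \<in> \<C> \<Longrightarrow>
          countable (h C) \<and> (\<forall>Y\<in>h C. homogeneous_in X K1 Y) \<and> C \<subseteq> \<Union>(h C)"
        using \<open>\<And>C. C \<in> \<C> \<Longrightarrow> I C\<close> unfolding I_def by metis
      have "countable (\<Union>(h ` \<C>))"
        using \<open>countable \<C>\<close> h by (simp add: countable_UN)
      moreover have "\<forall>Y\<in>\<Union>(h ` \<C>). homogeneous_in X K1 Y"
        using h by blast
      moreover have "\<Union>\<C> \<subseteq> \<Union>(\<Union>(h ` \<C>))"
      proof
        fix x assume "x \<in> \<Union>\<C>"
        then obtain C where "C \<in> \<C>" "x \<in> C" by blast
        moreover from this obtain Y where "Y \<in> h C" "x \<in> Y"
          using h by blast
        ultimately show "x \<in> \<Union>(\<Union>(h ` \<C>))" by blast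
      qed
      ultimately show ?thesis
        unfolding I_def by blast
    qed
    obtain Z where Z: "closedin X Z" "Z \<noteq> {}"
      "\<And>V. \<lbrakk>openin X V; V \<inter> Z \<noteq> {}\<rbrakk> \<Longrightarrow> \<not> I (V \<inter> Z)"
      by (rule sigma_ideal_kernel[OF assms(1), where I = I and A = "topspace X"])
        (use I_sub I_Union False in \<open>assumption | simp\<close>)+
    have ZX: "Z \<subseteq> topspace X"
      using Z(1) closedin_subset by blast
    have pair_in: "x \<noteq> y" if "{x, y} \<in> K0" for x y
      using that K doubleton_in_nsets_2[of x y "topspace X"] by blast
    have split: "\<exists>x\<in>V \<inter> Z. \<exists>y\<in>V \<inter> Z. (x, y) \<in> R" if V: "openin X V" "V \<inter> Z \<noteq> {}" for V
    proof -
      have "\<not> homogeneous_in X K1 (V \<inter> Z)"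
        using Z(3)[OF V] unfolding I_def by (metis Union_upper countable_empty countable_insert
          insertI1 singletonD)
      then obtain e where "e \<in> [V \<inter> Z]\<^bsup>2\<^esup>" "e \<notin> K1"
        using ZX by (auto simp: homogeneous_in_def)
      moreover from this obtain x y where "e = {x, y}" "x \<in> V \<inter> Z" "y \<in> V \<inter> Z"
        by (auto simp: nsets_def card_2_iff)
      moreover have "[V \<inter> Z]\<^bsup>2\<^esup> \<subseteq> [topspace X]\<^bsup>2\<^esup>"
        using ZX by (intro nsets_mono) auto
      ultimately show ?thesis
        using K ZX unfolding R_def by blast
    qed
    have R_open: "openin (prod_topology X X) R"
      using K0 by (simp add: open_in_pairs_def R_def)
    have R_irrefl: "(x, x) \<notin> R" for x
      using pair_in[of x x] unfolding R_def by blast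
    obtain C where C: "closedin X C" "uncountable C"
        "pairwise (\<lambda>x y. (x, y) \<in> R \<or> (y, x) \<in> R) C"
      using closed_uncountable_pairwise_related[OF assms(2,3) R_open R_irrefl ZX Z(2) split] .
    obtain P where P: "P \<subseteq> C" "perfect_in X P"
      using uncountable_closed_contains_perfect[OF assms(1) C(1,2)] .
    have "{x, y} \<in> K0" if "x \<in> P" "y \<in> P" "x \<noteq> y" for x y
    proof -
      have "(x, y) \<in> R \<or> (y, x) \<in> R"
        using C(3) P(1) that unfolding pairwise_def by blast
      then show ?thesis
        unfolding R_def using insert_commute[of x y "{}"] by fastforce
    qed
    then have "[P]\<^bsup>2\<^esup> \<subseteq> K0"
      by (metis nsets2_E subsetI)
    moreover have "P \<subseteq> topspace X"
      using P(1) C(1) closedin_subset by blast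
    ultimately show ?thesis
      using P(2) by (auto simp: homogeneous_in_def)
  qed
qed

end
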